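(* Let $(\mathcal{H}, * )$ be a semigroup with a zero element $\theta$. Suppose that all elements of $(\mathcal{H}, * )$ are idempotent and that $e_1 * e_2 = \theta$ holds for all distinct $e_1, e_2 \in \mathcal{H}$. Then $(\mathcal{H}, * )$ does not admit any $d$-transitive monomorphism of the form $\mathcal{H} \to \mathcal{B}_X$.
   Context: A semigroup is a nonempty set with an associative operation. A zero of a semigroup is an element $\theta$ with $\theta * s = s * \theta = \theta$ for all $s$; by convention a semigroup must have at least two elements to possess a zero. An element $i$ is idempotent if $i * i = i$. $\mathcal{B}_X$ is the semigroup of all binary relations on a set $X$ (subsets of $X^2$) under composition: $\langle x,y\rangle \in \psi \circ \gamma$ iff there is $z \in X$ with $\langle x,z\rangle \in \psi$ and $\langle z,y\rangle \in \gamma$. A monomorphism is an injective homomorphism. A partition of a nonempty set is a set of nonempty pairwise disjoint subsets whose union is the whole set; there is no partition of $\varnothing$. A set $A \subseteq \mathcal{H}$ is a set of generators of $\mathcal{H}$ if every element of $\mathcal{H}$ is a product of a finite sequence (of length at least one) of elements of $A$. A monomorphism $\Phi : \mathcal{H} \to \mathcal{B}_X$ is $d$-transitive if there is a set $A$ of generators of $(\mathcal{H}, * )$ such that $\{\Phi(a) : a \in A\}$ is a partition of $X^2$ and, if $\mathcal{H}$ contains a zero element $\theta$, then $\Phi(\theta) = \varnothing$. *)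

theory Defs
  imports "HOL-Algebra.Group" "HOL-Library.Disjoint_Sets"
begin

(* Semigroups are carried by the monoid record, so that hom and mon apply;
   only carrier and mult matter, the field one is never used. *)
locale nonempty_semigroup =
  fixes H (structure)
  assumes nonempty: "carrier H \<noteq> {}"
    and m_closed: "\<lbrakk>x \<in> carrier H; y \<in> carrier H\<rbrakk> \<Longrightarrow> x \<otimes> y \<in> carrier H"
    and m_assoc: "\<lbrakk>x \<in> carrier H; y \<in> carrier H; z \<in> carrier H\<rbrakk>
      \<Longrightarrow> (x \<otimes> y) \<otimes> z = x \<otimes> (y \<otimes> z)"

(* The first conjunct is the convention that only a semigroup with at least
   two elements can possess a zero. *)
definition is_zero_element :: "('a, 'm) monoid_scheme \<Rightarrow> 'a \<Rightarrow> bool" where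
  "is_zero_element H z \<longleftrightarrow>
     (\<exists>x \<in> carrier H. \<exists>y \<in> carrier H. x \<noteq> y) \<and>
     z \<in> carrier H \<and>
     (\<forall>s \<in> carrier H. z \<otimes>\<^bsub>H\<^esub> s = z \<and> s \<otimes>\<^bsub>H\<^esub> z = z)"

definition idempotent_element :: "('a, 'm) monoid_scheme \<Rightarrow> 'a \<Rightarrow> bool" where
  "idempotent_element H i \<longleftrightarrow> i \<in> carrier H \<and> i \<otimes>\<^bsub>H\<^esub> i = i"

(* relcomp composes from left to right: (x, y) is in r O s iff there is z with
   (x, z) in r and (z, y) in s. *)
definition rel_semigroup :: "'x set \<Rightarrow> ('x \<times> 'x) set monoid" where
  "rel_semigroup X = \<lparr>carrier = Pow (X \<times> X), mult = (O), one = Id_on X\<rparr>"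

(* Relevant for nonempty lists only; the empty list has no product in a semigroup. *)
definition seq_product :: "('a, 'm) monoid_scheme \<Rightarrow> 'a list \<Rightarrow> 'a" where
  "seq_product H xs = foldl (\<lambda>x y. x \<otimes>\<^bsub>H\<^esub> y) (hd xs) (tl xs)"

definition is_generating_set :: "('a, 'm) monoid_scheme \<Rightarrow> 'a set \<Rightarrow> bool" where
  "is_generating_set H A \<longleftrightarrow>
     A \<subseteq> carrier H \<and>
     (\<forall>h \<in> carrier H. \<exists>xs. xs \<noteq> [] \<and> set xs \<subseteq> A \<and> h = seq_product H xs)"

(* Unlike for partition_on, there is no partition of the empty set. *)
definition is_partition :: "'a set \<Rightarrow> 'a set set \<Rightarrow> bool" where
  "is_partition S P \<longleftrightarrow> S \<noteq> {} \<and> partition_on S P"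

definition d_transitive_mon ::
    "('a, 'm) monoid_scheme \<Rightarrow> 'x set \<Rightarrow> ('a \<Rightarrow> ('x \<times> 'x) set) \<Rightarrow> bool" where
  "d_transitive_mon H X \<Phi> \<longleftrightarrow>
     \<Phi> \<in> mon H (rel_semigroup X) \<and>
     (\<exists>A. is_generating_set H A \<and> is_partition (X \<times> X) (\<Phi> ` A)) \<and>
     (\<forall>z. is_zero_element H z \<longrightarrow> \<Phi> z = {})"

end

theory Submission
  imports Defs
begin

text \<open>
  Blocks indexed by distinct generators cannot be composed, since the composite is \<open>\<Phi> \<theta> = {}\<close>.
  But any two pairs \<open>(x, y)\<close> and \<open>(z, w)\<close> are linked through \<open>(y, z)\<close>, so the partition of
  \<open>X\<^sup>2\<close> has a single block and there is only one generator. Being idempotent, it generates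
  nothing but itself, so it equals \<open>\<theta>\<close> and its block is empty.
\<close>

text \<open>Meant for the sole generator: by idempotency each further factor is absorbed, so words
  of every length collapse.\<close>

lemma seq_product_idempotent:
  assumes "x \<otimes>\<^bsub>H\<^esub> x = x" "xs \<noteq> []" "set xs \<subseteq> {x}"
  shows "seq_product H xs = x"
proof -
  have "foldl (\<lambda>x y. x \<otimes>\<^bsub>H\<^esub> y) x ys = x" if "set ys \<subseteq> {x}" for ys
    using that assms(1) by (induction ys) auto
  with assms(2,3) show ?thesis
    by (cases xs) (auto simp: seq_product_def)
qed

theorem proposition3p9:
  fixes H :: "('a, 'm) monoid_scheme" and \<theta> :: 'a
  assumes "nonempty_semigroup H"
    and "is_zero_element H \<theta>"
    and "\<And>e. e \<in> carrier H \<Longrightarrow> idempotent_element H e"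
    and "\<And>e1 e2. \<lbrakk>e1 \<in> carrier H; e2 \<in> carrier H; e1 \<noteq> e2\<rbrakk> \<Longrightarrow> e1 \<otimes>\<^bsub>H\<^esub> e2 = \<theta>"
  shows "\<not> (\<exists>(X :: 'x set) \<Phi>. d_transitive_mon H X \<Phi>)"
proof
  assume "\<exists>(X :: 'x set) \<Phi>. d_transitive_mon H X \<Phi>"
  then obtain X :: "'x set" and \<Phi> A where mon: "\<Phi> \<in> mon H (rel_semigroup X)"
    and gen: "is_generating_set H A" and part: "is_partition (X \<times> X) (\<Phi> ` A)"
    and zero: "\<Phi> \<theta> = {}"
    using assms(2) unfolding d_transitive_mon_def by blast
  have A: "A \<subseteq> carrier H"
    using gen by (simp add: is_generating_set_def)
  have mult: "\<Phi> (a \<otimes>\<^bsub>H\<^esub> b) = \<Phi> a O \<Phi> b" if "a \<in> A" "b \<in> A" for a b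
    using mon that A by (simp add: mon_def hom_def rel_semigroup_def subset_iff)
  have cover: "\<exists>a\<in>A. p \<in> \<Phi> a" if "p \<in> X \<times> X" for p
    using part that by (auto simp: is_partition_def partition_on_def)
  have subset: "\<Phi> a \<subseteq> X \<times> X" if "a \<in> A" for a
    using part that by (auto simp: is_partition_def partition_on_def)
  have nonempty: "\<Phi> a \<noteq> {}" if "a \<in> A" for a
    using part that by (auto simp: is_partition_def partition_on_def)
  have link: "a = b" if "a \<in> A" "b \<in> A" "(x, y) \<in> \<Phi> a" "(y, z) \<in> \<Phi> b" for a b x y z
  proof (rule ccontr)
    assume "a \<noteq> b"
    then have "\<Phi> a O \<Phi> b = {}"
      using mult[of a b] assms(4)[of a b] that A zero by auto
    \<comment> \<open>The shared point \<open>y\<close> puts \<open>(x, z)\<close> into the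
      composite.\<close>
    with that show False by blast
  qed
  \<comment> \<open>As the empty set has no partition, \<open>X \<times> X\<close> contains a pair,
    and some block covers it.\<close>
  obtain e where e: "e \<in> A"
    using part cover unfolding is_partition_def by blast
  have single: "a = e" if "a \<in> A" for a
  proof -
    obtain x y z w where xy: "(x, y) \<in> \<Phi> e" and zw: "(z, w) \<in> \<Phi> a"
      using nonempty[OF e] nonempty[OF \<open>a \<in> A\<close>] by fast
    then have "(y, z) \<in> X \<times> X"
      using subset[OF e] subset[OF \<open>a \<in> A\<close>] by blast
    then obtain b where "b \<in> A" "(y, z) \<in> \<Phi> b"
      using cover by blast
    \<comment> \<open>Two uses of \<open>link\<close>: \<open>y\<close> joins \<open>e\<close> to
      \<open>b\<close>, then \<open>z\<close> joins \<open>b\<close> to \<open>a\<close>.\<close>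
    with link e that xy zw show ?thesis by metis
  qed
  \<comment> \<open>The zero must itself be a word in the generators, which forces it to be
    \<open>e\<close>.\<close>
  have "\<theta> \<in> carrier H"
    using assms(2) by (simp add: is_zero_element_def)
  then obtain xs where "xs \<noteq> []" "set xs \<subseteq> A" "\<theta> = seq_product H xs"
    using gen by (auto simp: is_generating_set_def)
  moreover have "e \<otimes>\<^bsub>H\<^esub> e = e"
    using assms(3) e A by (auto simp: idempotent_element_def)
  ultimately have "\<theta> = e"
    using single seq_product_idempotent[of H e xs] by blast
  with nonempty e zero show False by blast
qed

end
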